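(* Let $(X,d)$ be a CAT$(0)$ space and let $T_1,T_2:X\to X$ satisfy property $(P_2)$. Denote $S:=T_2\circ T_1$ and suppose that $\mathrm{Fix}(S)\neq\emptyset$. Let $x_0\in X$ and $b>0$ be such that there exists $u\in \mathrm{Fix}(S)$ with $2d(x_0,u)\le b$. Define the sequences $(x_n)$ and $(y_n)$ by $$y_n:=T_1x_n\quad\text{and}\quad x_{n+1}:=T_2y_n,\qquad n\in\mathbb{N}.$$ Then $$\forall \varepsilon>0\ \forall n\ge \Phi(\varepsilon,b)\ \bigl(d(y_n,y_{n+1})\le d(x_n,x_{n+1})\le\varepsilon\bigr),$$ where $$\Phi(\varepsilon,b):=k\left\lceil\frac{2b(1+2^k)}{\varepsilon}\right\rceil+1,\quad\text{with } k:=\left\lceil\frac{2b}{\varepsilon}\right\rceil.$$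
   Context: $\mathbb{N}=\{0,1,2,\dots\}$. A CAT$(0)$ space is a geodesic metric space $(X,d)$ (any two points are joined by a geodesic path) satisfying, for all $x,y,u,v\in X$, $d(x,y)^2+d(u,v)^2\le d(x,v)^2+d(y,u)^2+2d(x,u)d(y,v)$ (this is equivalent to the usual definition). A mapping $T:X\to X$ satisfies property $(P_2)$ if $2d(Tx,Ty)^2\le d(x,Ty)^2+d(y,Tx)^2-d(x,Tx)^2-d(y,Ty)^2$ for all $x,y\in X$. $\mathrm{Fix}(S)=\{x\in X: Sx=x\}$. *)

theory Defs
  imports "HOL-Analysis.Analysis"
begin

text \<open>Geodesic paths are unit-speed: isometric embeddings of the interval from 0 to l,
  so that necessarily l = d x y.\<close>

definition geodesic_path ::
  "'a set \<Rightarrow> ('a \<Rightarrow> 'a \<Rightarrow> real) \<Rightarrow> 'a \<Rightarrow> 'a \<Rightarrow> real \<Rightarrow> (real \<Rightarrow> 'a) \<Rightarrow> bool" where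
  "geodesic_path X d x y l c \<longleftrightarrow>
     0 \<le> l \<and> c \<in> {0..l} \<rightarrow> X \<and> c 0 = x \<and> c l = y \<and>
     (\<forall>s\<in>{0..l}. \<forall>t\<in>{0..l}. d (c s) (c t) = \<bar>s - t\<bar>)"

locale geodesic_space = Metric_space X d
  for X :: "'a set" and d :: "'a \<Rightarrow> 'a \<Rightarrow> real" +
  assumes geodesic: "\<lbrakk>x \<in> X; y \<in> X\<rbrakk> \<Longrightarrow> \<exists>l c. geodesic_path X d x y l c"

locale CAT0_space = geodesic_space X d
  for X :: "'a set" and d :: "'a \<Rightarrow> 'a \<Rightarrow> real" +
  assumes four_point: "\<lbrakk>x \<in> X; y \<in> X; u \<in> X; v \<in> X\<rbrakk> \<Longrightarrow>
    (d x y)\<^sup>2 + (d u v)\<^sup>2 \<le> (d x v)\<^sup>2 + (d y u)\<^sup>2 + 2 * d x u * d y v"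

definition property_P2 :: "'a set \<Rightarrow> ('a \<Rightarrow> 'a \<Rightarrow> real) \<Rightarrow> ('a \<Rightarrow> 'a) \<Rightarrow> bool" where
  "property_P2 X d T \<longleftrightarrow>
     (\<forall>x\<in>X. \<forall>y\<in>X. 2 * (d (T x) (T y))\<^sup>2
        \<le> (d x (T y))\<^sup>2 + (d y (T x))\<^sup>2 - (d x (T x))\<^sup>2 - (d y (T y))\<^sup>2)"

definition Fix :: "'a set \<Rightarrow> ('a \<Rightarrow> 'a) \<Rightarrow> 'a set" where
  "Fix X S = {x \<in> X. S x = x}"

text \<open>Used only for positive arguments, where both ceilings are positive and
  the conversions to natural numbers lose nothing.\<close>

definition Phi :: "real \<Rightarrow> real \<Rightarrow> nat" where
  "Phi \<epsilon> b = (let k = nat \<lceil>2 * b / \<epsilon>\<rceil> in k * nat \<lceil>2 * b * (1 + 2 ^ k) / \<epsilon>\<rceil> + 1)"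

end

theory Submission
  imports Defs
begin

text \<open>
  The theorem follows from one inequality for \<open>S = T2 \<circ> T1\<close>: every \<open>p\<close> and \<open>q\<close> satisfy
  \<open>2 d (S p) (S q) \<le> d p (S q) + d q (S p)\<close> (lemma \<open>P2_comp_midpoint_ineq\<close>). To get it, add the
  two instances of property \<open>(P2)\<close>; the resulting squared distances form two four-point
  configurations, and an application of the arithmetic-geometric mean inequality removes the
  squares. Also, \<open>(P2)\<close> maps are nonexpansive, so the step sizes \<open>a n = d (x n) (x (n + 1))\<close>
  decrease and the distances from \<open>x n\<close> to a fixed point \<open>u\<close> of \<open>S\<close> do not increase.

  Read along the orbit, the inequality says
  \<open>d (x i) (x (i + j + 1)) \<ge> 2 d (x (i + 1)) (x (i + j + 1)) - d (x (i + 1)) (x (i + j))\<close>.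
  If the step sizes were all equal to \<open>a\<close>, induction on \<open>j\<close> would give
  \<open>d (x i) (x (i + j)) = j a\<close>: the orbit moves along a straight line. Since it stays within \<open>b / 2\<close>
  of \<open>u\<close>, this would force \<open>a = 0\<close>. Quantitatively, if the step sizes drop by at most \<open>\<delta>\<close> over
  a block of length \<open>k\<close>, the error doubles at each induction step, so that
  \<open>d (x i) (x (i + k)) \<ge> k a - 2 ^ (k - 1) \<delta>\<close> (lemma \<open>almost_constant_steps_lower_bound\<close>). With
  \<open>k \<ge> 2 b / \<epsilon>\<close> and \<open>\<delta> = \<epsilon> / (2 (1 + 2 ^ k))\<close> this contradicts
  \<open>d (x i) (x (i + k)) \<le> b\<close> as soon as \<open>a > \<epsilon>\<close> (and \<open>\<epsilon> < b\<close>, which may be supposed because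
  \<open>a 0 \<le> b\<close>). Finally, the step sizes lie between \<open>0\<close> and \<open>b\<close>, so among \<open>\<lceil>b / \<delta>\<rceil>\<close>
  consecutive blocks there is one on which they drop by at most \<open>\<delta>\<close> (lemma \<open>small_drop_block\<close>).
  This accounts for the form of the rate \<open>Phi\<close>.
\<close>

context CAT0_space
begin

text \<open>The right-hand side of \<open>(P2)\<close> is exactly what the four-point inequality for the points
  \<open>p, T q, q, T p\<close> bounds by \<open>2 d p q * d (T p) (T q)\<close>.\<close>

lemma P2_nonexpansive:
  assumes T: "T \<in> X \<rightarrow> X" "property_P2 X d T" and pq: "p \<in> X" "q \<in> X"
  shows "d (T p) (T q) \<le> d p q"
proof -
  have TX: "T p \<in> X" "T q \<in> X"
    using T(1) pq by auto
  have "2 * (d (T p) (T q))\<^sup>2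
      \<le> (d p (T q))\<^sup>2 + (d q (T p))\<^sup>2 - (d p (T p))\<^sup>2 - (d q (T q))\<^sup>2"
    using T(2) pq by (auto simp: property_P2_def)
  also have "\<dots> \<le> 2 * d p q * d (T p) (T q)"
    using four_point[of p "T q" q "T p"] pq TX by (simp add: commute)
  finally have *: "d (T p) (T q) * d (T p) (T q) \<le> d p q * d (T p) (T q)"
    by (simp add: power2_eq_square)
  show ?thesis
  proof (cases "d (T p) (T q) = 0")
    case False
    then have "0 < d (T p) (T q)"
      using nonneg[of "T p" "T q"] by linarith
    with * show ?thesis
      by (rule mult_right_le_imp_le)
  qed simp
qed

text \<open>Write \<open>A = d (T1 p) (T1 q)\<close> and \<open>B = d (T2 (T1 p)) (T2 (T1 q))\<close>. Adding the inequalities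
  \<open>(P2)\<close> for \<open>T1\<close> at \<open>p, q\<close> and for \<open>T2\<close> at \<open>T1 p, T1 q\<close> gives eight squared distances on
  the right. Grouped suitably, they are bounded by two four-point inequalities that share
  the factor \<open>A\<close>, so \<open>A\<^sup>2 + B\<^sup>2 \<le> A * R\<close> with \<open>R\<close> the right-hand side of the claim. As
  \<open>2 * A * B \<le> A\<^sup>2 + B\<^sup>2\<close>, division by \<open>A\<close> gives the result; if \<open>A = 0\<close>, then \<open>B = 0\<close>
  because \<open>T2\<close> is nonexpansive.\<close>

lemma P2_comp_midpoint_ineq:
  assumes T1: "T1 \<in> X \<rightarrow> X" "property_P2 X d T1"
    and T2: "T2 \<in> X \<rightarrow> X" "property_P2 X d T2"
    and pq: "p \<in> X" "q \<in> X"
  shows "2 * d (T2 (T1 p)) (T2 (T1 q)) \<le> d p (T2 (T1 q)) + d q (T2 (T1 p))"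
proof -
  define p' q' p'' q'' where pq_defs: "p' = T1 p" "q' = T1 q" "p'' = T2 p'" "q'' = T2 q'"
  have X: "p' \<in> X" "q' \<in> X" "p'' \<in> X" "q'' \<in> X"
    using T1(1) T2(1) pq by (auto simp: pq_defs)
  define A B R where AB_defs: "A = d p' q'" "B = d p'' q''" "R = d p q'' + d q p''"
  have "2 * A\<^sup>2 \<le> (d p q')\<^sup>2 + (d q p')\<^sup>2 - (d p p')\<^sup>2 - (d q q')\<^sup>2"
    using T1(2) pq by (auto simp: property_P2_def pq_defs AB_defs)
  moreover have "2 * B\<^sup>2 \<le> (d p' q'')\<^sup>2 + (d q' p'')\<^sup>2 - (d p' p'')\<^sup>2 - (d q' q'')\<^sup>2"
    using T2(2) X by (auto simp: property_P2_def pq_defs AB_defs)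
  moreover have "(d p q')\<^sup>2 + (d p' q'')\<^sup>2 \<le> (d p p')\<^sup>2 + (d q' q'')\<^sup>2 + 2 * d p q'' * A"
    using four_point[of p q' q'' p'] pq X by (simp add: commute AB_defs)
  moreover have "(d q p')\<^sup>2 + (d q' p'')\<^sup>2 \<le> (d q q')\<^sup>2 + (d p' p'')\<^sup>2 + 2 * d q p'' * A"
    using four_point[of q p' p'' q'] pq X by (simp add: commute AB_defs)
  ultimately have sum: "A\<^sup>2 + B\<^sup>2 \<le> R * A"
    by (simp add: AB_defs algebra_simps)
  have "2 * B \<le> R"
  proof (cases "A = 0")
    case True
    then have "B = 0"
      using P2_nonexpansive[OF T2 X(1,2)] nonneg[of p'' q''] unfolding AB_defs pq_defs by linarith
    then show ?thesis
      by (simp add: AB_defs)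
  next
    case False
    then have "0 < A"
      using nonneg[of p' q'] unfolding AB_defs by linarith
    have "2 * B * A \<le> R * A"
      using sum sum_squares_bound[of A B] by (simp add: mult.commute mult.left_commute)
    then show ?thesis
      using \<open>0 < A\<close> by (rule mult_right_le_imp_le)
  qed
  then show ?thesis
    by (simp add: AB_defs pq_defs)
qed

end

context Metric_space
begin

lemma dist_le_steps:
  assumes X: "\<And>n. x n \<in> M" and step: "\<And>n. N \<le> n \<Longrightarrow> d (x n) (x (Suc n)) \<le> a" and "N \<le> i"
  shows "d (x i) (x (i + j)) \<le> real j * a"
proof (induction j)
  case 0
  show ?case
    by (simp add: X)
next
  case (Suc j)
  have "d (x i) (x (i + Suc j)) \<le> d (x i) (x (i + j)) + d (x (i + j)) (x (Suc (i + j)))"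
    using triangle[OF X X X] by simp
  also have "\<dots> \<le> real j * a + a"
    using Suc.IH step \<open>N \<le> i\<close> by (intro add_mono) auto
  finally show ?case
    by (simp add: algebra_simps)
qed

text \<open>The orbit is nearly straight where its step size is nearly constant. In the step from \<open>j\<close> to \<open>j + 1\<close> the inequality bounds the new
  distance from below by twice a distance over \<open>j\<close> steps, whose error is known, minus a distance
  over \<open>j - 1\<close> steps, which is at most \<open>(j - 1) a\<close>; hence the error exactly doubles.\<close>

lemma almost_constant_steps_lower_bound:
  assumes X: "\<And>n. x n \<in> M"
    and mid: "\<And>m n. 2 * d (x (Suc m)) (x (Suc n)) \<le> d (x m) (x (Suc n)) + d (x n) (x (Suc m))"
    and upper: "\<And>n. N \<le> n \<Longrightarrow> d (x n) (x (Suc n)) \<le> a"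
    and lower: "\<And>n. N \<le> n \<Longrightarrow> n < N + k \<Longrightarrow> a - \<delta> \<le> d (x n) (x (Suc n))"
    and "N \<le> i" "i + Suc j \<le> N + k"
  shows "real (Suc j) * a - 2 ^ j * \<delta> \<le> d (x i) (x (i + Suc j))"
  using \<open>N \<le> i\<close> \<open>i + Suc j \<le> N + k\<close>
proof (induction j arbitrary: i)
  case 0
  then show ?case
    using lower[of i] by simp
next
  case (Suc j)
  have "real (Suc j) * a - 2 ^ j * \<delta> \<le> d (x (Suc i)) (x (Suc i + Suc j))"
    using Suc.IH[of "Suc i"] Suc.prems by simp
  moreover have "d (x (Suc i)) (x (Suc i + j)) \<le> real j * a"
    using Suc.prems by (intro dist_le_steps[where x = x and N = N, OF X upper]) auto
  moreover have "2 * d (x (Suc i)) (x (Suc i + Suc j))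
      \<le> d (x i) (x (i + Suc (Suc j))) + d (x (Suc i)) (x (Suc i + j))"
    using mid[of i "i + Suc j"] by (simp add: commute)
  ultimately show ?case
    by (simp add: algebra_simps)
qed

end

text \<open>Pigeonhole principle: \<open>m\<close> consecutive drops larger than \<open>\<delta>\<close> would take \<open>a\<close> from at most
  \<open>m * \<delta>\<close> to below \<open>0\<close>.\<close>

lemma small_drop_block:
  fixes a :: "nat \<Rightarrow> real"
  assumes nonneg: "\<And>n. 0 \<le> a n" and start: "a 0 \<le> real m * \<delta>" and "0 < m"
  obtains (block) i where "i < m" "a (i * k) - a (i * k + k) \<le> \<delta>"
proof (rule ccontr)
  assume "\<not> thesis"
  then have drop: "\<delta> < a (i * k) - a (Suc i * k)" if "i < m" for i
    using block[OF that] by (force simp: add.commute)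
  have "(\<Sum>i<m. \<delta>) < (\<Sum>i<m. a (i * k) - a (Suc i * k))"
    using drop \<open>0 < m\<close> by (intro sum_strict_mono) auto
  also have "\<dots> = a 0 - a (m * k)"
    by (subst sum_lessThan_telescope') simp
  finally show False
    using nonneg[of "m * k"] start by simp
qed

theorem theorem3p1:
  fixes X :: "'a set" and d :: "'a \<Rightarrow> 'a \<Rightarrow> real"
    and T1 T2 S :: "'a \<Rightarrow> 'a" and x0 :: 'a and b :: real
    and x y :: "nat \<Rightarrow> 'a"
  assumes "CAT0_space X d"
    and "T1 \<in> X \<rightarrow> X" and "T2 \<in> X \<rightarrow> X"
    and "property_P2 X d T1" and "property_P2 X d T2"
    and "S = T2 \<circ> T1"
    and "Fix X S \<noteq> {}"
    and "x0 \<in> X" and "b > 0"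
    and "\<exists>u\<in>Fix X S. 2 * d x0 u \<le> b"
    and "x 0 = x0"
    and "\<And>n. y n = T1 (x n)"
    and "\<And>n. x (Suc n) = T2 (y n)"
  shows "\<forall>\<epsilon>>0. \<forall>n\<ge>Phi \<epsilon> b.
           d (y n) (y (Suc n)) \<le> d (x n) (x (Suc n)) \<and> d (x n) (x (Suc n)) \<le> \<epsilon>"
proof (intro allI impI)
  fix \<epsilon> :: real and n
  assume "0 < \<epsilon>" and n: "Phi \<epsilon> b \<le> n"
  interpret CAT0_space X d
    by fact
  note T1 = assms(2,4) and T2 = assms(3,5)
  have yT: "y m = T1 (x m)" and xT: "x (Suc m) = T2 (T1 (x m))" for m
    using assms by auto
  have xX: "x m \<in> X" for m
  proof (induction m)
    case 0
    show ?case using assms by simp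
  next
    case (Suc m)
    then show ?case using T1(1) T2(1) by (auto simp: xT)
  qed
  have T1X: "T1 p \<in> X" if "p \<in> X" for p
    using T1(1) that by auto
  have S_nonexp: "d (T2 (T1 p)) (T2 (T1 q)) \<le> d p q" if "p \<in> X" "q \<in> X" for p q
    using P2_nonexpansive[OF T2 T1X T1X, OF that] P2_nonexpansive[OF T1 that] by linarith

  obtain u where u: "u \<in> X" "T2 (T1 u) = u" "2 * d x0 u \<le> b"
    using assms(6,10) by (auto simp: Fix_def)
  have near_u: "2 * d (x m) u \<le> b" for m
  proof (induction m)
    case 0
    show ?case using u assms(11) by simp
  next
    case (Suc m)
    have "d (x (Suc m)) u \<le> d (x m) u"
      using S_nonexp[OF xX[of m] u(1)] u(2) by (simp add: xT)
    with Suc show ?case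
      by linarith
  qed
  have diam: "d (x i) (x j) \<le> b" for i j
    using triangle[OF xX[of i] u(1) xX[of j]] near_u[of i] near_u[of j] by (simp add: commute)

  define a where "a m = d (x m) (x (Suc m))" for m
  have "decseq a"
    unfolding decseq_Suc_iff a_def by (metis S_nonexp xT xX)

  have "a n \<le> \<epsilon>"
  proof (cases "b \<le> \<epsilon>")
    case True
    then show ?thesis
      using diam[of n "Suc n"] by (simp add: a_def)
  next
    case False
    define k where "k = nat \<lceil>2 * b / \<epsilon>\<rceil>"
    define m where "m = nat \<lceil>2 * b * (1 + 2 ^ k) / \<epsilon>\<rceil>"
    \<comment> \<open>Small enough for \<open>2 ^ (k - 1) * \<delta> \<le> \<epsilon>\<close>, large enough for \<open>b \<le> m * \<delta>\<close>.\<close>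
    define \<delta> where "\<delta> = \<epsilon> / (2 * (1 + 2 ^ k))"
    have pos2: "(0::real) < 1 + 2 ^ k"
      by (simp add: add_pos_pos)
    have "0 < k" "0 < m"
      using \<open>0 < b\<close> \<open>0 < \<epsilon>\<close> pos2 by (simp_all add: k_def m_def)
    have k: "2 * b \<le> real k * \<epsilon>"
      using \<open>0 < \<epsilon>\<close> real_nat_ceiling_ge[of "2 * b / \<epsilon>"] by (simp add: k_def field_simps)
    have "2 * b * (1 + 2 ^ k) \<le> real m * \<epsilon>"
      using \<open>0 < \<epsilon>\<close> real_nat_ceiling_ge[of "2 * b * (1 + 2 ^ k) / \<epsilon>"]
      by (simp add: m_def pos_divide_le_eq)
    then have "b \<le> real m * \<delta>"
      using pos2 by (simp add: \<delta>_def pos_le_divide_eq mult_ac)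
    then have "a 0 \<le> real m * \<delta>"
      using diam[of 0 "Suc 0"] by (simp add: a_def)
    then obtain i where i: "i < m" "a (i * k) - a (i * k + k) \<le> \<delta>"
      using small_drop_block[of a m \<delta> k] \<open>0 < m\<close> by (auto simp: a_def)

    have "a (i * k) \<le> \<epsilon>"
    proof (rule ccontr)
      assume "\<not> a (i * k) \<le> \<epsilon>"
      have "real (Suc (k - 1)) * a (i * k) - 2 ^ (k - 1) * \<delta>
          \<le> d (x (i * k)) (x (i * k + Suc (k - 1)))"
      proof (rule almost_constant_steps_lower_bound[where N = "i * k" and k = k])
        show "2 * d (x (Suc p)) (x (Suc q)) \<le> d (x p) (x (Suc q)) + d (x q) (x (Suc p))" for p q
          using P2_comp_midpoint_ineq[OF T1 T2 xX xX] by (simp add: xT)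
        show "d (x p) (x (Suc p)) \<le> a (i * k)" if "i * k \<le> p" for p
          using decseqD[OF \<open>decseq a\<close> that] by (simp add: a_def)
        show "a (i * k) - \<delta> \<le> d (x p) (x (Suc p))" if "p < i * k + k" for p
          using decseqD[OF \<open>decseq a\<close>, of p "i * k + k"] that i(2) by (simp add: a_def)
      qed (use \<open>0 < k\<close> xX in auto)
      then have "real k * a (i * k) - 2 ^ (k - 1) * \<delta> \<le> b"
        using diam[of "i * k" "i * k + k"] \<open>0 < k\<close> by simp
      moreover have "2 * b < real k * a (i * k)"
        using k mult_strict_left_mono[of \<epsilon> "a (i * k)" "real k"] \<open>0 < k\<close> \<open>\<not> a (i * k) \<le> \<epsilon>\<close>
        by linarith
      moreover have "2 ^ (k - 1) * \<delta> \<le> b"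
      proof -
        have "(2::real) ^ (k - 1) \<le> 2 * (1 + 2 ^ k)"
          using power_increasing[of "k - 1" k "2::real"] pos2 by (smt (verit) diff_le_self)
        then have "2 ^ (k - 1) * \<epsilon> \<le> 2 * (1 + 2 ^ k) * \<epsilon>"
          using \<open>0 < \<epsilon>\<close> by (intro mult_right_mono) auto
        then have "2 ^ (k - 1) * \<delta> \<le> \<epsilon>"
          using pos2 by (simp add: \<delta>_def pos_divide_le_eq mult_ac)
        with False show ?thesis
          by simp
      qed
      ultimately show False
        by simp
    qed
    moreover have "i * k \<le> n"
    proof -
      have "i * k \<le> k * m"
        using i(1) by (simp add: mult.commute)
      also have "\<dots> \<le> Phi \<epsilon> b"
        by (simp add: Phi_def Let_def k_def m_def)
      finally show ?thesis
        using n by simp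
    qed
    ultimately show ?thesis
      using decseqD[OF \<open>decseq a\<close>] order_trans by blast
  qed
  moreover have "d (y n) (y (Suc n)) \<le> a n"
    using P2_nonexpansive[OF T1 xX xX] by (simp add: yT a_def)
  ultimately show "d (y n) (y (Suc n)) \<le> d (x n) (x (Suc n)) \<and> d (x n) (x (Suc n)) \<le> \<epsilon>"
    by (simp add: a_def)
qed

end
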